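(* Let $X$ be a normed linear space and let $S=(X;X_k,k\geqslant 1)$ be a system of closed linear subspaces of $X$. Put $$\Delta(S)=\{x\in X : \liminf_{k\to\infty} d(x,X_k)=0\}.$$ If the closure of the linear span of $\Delta(S)$ equals $X$, then $S$ is a permutational representing system of subspaces in $X$.
   Context: $X$ is a normed linear space over $\mathbb{K}$ ($=\mathbb{R}$ or $\mathbb{C}$), not assumed complete. For $x\in X$ and $F\subset X$, $d(x,F)$ is the distance from $x$ to $F$. A system $S=(X;X_k,k\geqslant 1)$ of closed linear subspaces of $X$ is a representing system of subspaces in $X$ if every $x\in X$ can be written as a norm-convergent series $x=\sum_{k=1}^\infty x_k$ with $x_k\in X_k$, $k\geqslant 1$. The system $S$ is a permutational representing system of subspaces in $X$ if for every bijection $\sigma:\mathbb{N}\to\mathbb{N}$ the system $S_\sigma=(X;X_{\sigma(k)},k\geqslant 1)$ is a representing system of subspaces in $X$. *)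

theory Defs
  imports "HOL-Analysis.Analysis"
begin

(* The scalar field K is a type of class real_normed_field. By the Gelfand-Mazur theorem every
   such type is R or C up to isometric isomorphism, so this class captures "K = R or C".
   The space X is the whole type 'a, and its norm is that of class real_normed_vector; neither
   'a nor 'k is assumed complete. Compatibility of scl with the real scalar multiplication of
   'a need not be assumed: it follows, by scale_of_real below. *)

locale normed_space_over = vector_space scl
  for scl :: "'k::real_normed_field \<Rightarrow> 'a::real_normed_vector \<Rightarrow> 'a" +
  assumes norm_scale: "norm (scl c x) = norm c * norm x"
begin

lemma scale_of_real: "scl (of_real r) x = r *\<^sub>R x"
proof -
  have nat: "scl (of_nat n) y = real n *\<^sub>R y" for n y
    by (induction n) (simp_all add: scale_left_distrib scaleR_left_distrib add.commute)
  have int: "scl (of_int m) y = real_of_int m *\<^sub>R y" for m y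
    by (cases m rule: int_cases2) (simp_all add: nat)
  have rat: "scl (of_real q) x = q *\<^sub>R x" if q: "q \<in> \<rat>" for q
  proof -
    obtain a b :: int where b: "b > 0" and qab: "q = of_int a / of_int b"
      using q by (auto elim: Rats_cases')
    have "real_of_int b *\<^sub>R scl (of_real q) x = scl (of_int b * of_real q) x"
      by (simp flip: int)
    also have "of_int b * of_real q = (of_int a :: 'k)"
      using b by (simp add: qab)
    also have "scl (of_int a) x = real_of_int b *\<^sub>R (q *\<^sub>R x)"
      using b by (simp add: int qab)
    finally show ?thesis
      using b by (simp del: scaleR_scaleR)
  qed
  have lip: "norm (scl (of_real a) x - scl (of_real b) x) = \<bar>a - b\<bar> * norm x" for a b
    by (simp add: scale_left_diff_distrib[symmetric] norm_scale flip: of_real_diff)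
  have "continuous_on UNIV (\<lambda>c::real. scl (of_real c) x)"
    by (rule lipschitz_on_continuous_on[of "norm x"], rule lipschitz_onI)
      (auto simp: dist_norm lip)
  then have "closed {c::real. scl (of_real c) x = c *\<^sub>R x}"
    by (intro closed_Collect_eq continuous_intros)
  then have "closure \<rat> \<subseteq> {c::real. scl (of_real c) x = c *\<^sub>R x}"
    by (intro closure_minimal) (auto simp: rat)
  then show ?thesis
    by (auto simp: Rats_closure_real)
qed

end

lemma normed_space_over_scaleR:
  "normed_space_over (scaleR :: real \<Rightarrow> 'a::real_normed_vector \<Rightarrow> 'a)"
  by unfold_locales (simp_all add: algebra_simps)

lemma normed_space_over_times:
  "normed_space_over (times :: 'k::real_normed_field \<Rightarrow> 'k \<Rightarrow> 'k)"
  by unfold_locales (simp_all add: algebra_simps norm_mult)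

(* Systems are indexed from 0: V k stands for the subspace with index k + 1. *)

definition closed_subspace_system ::
  "('k::real_normed_field \<Rightarrow> 'a::real_normed_vector \<Rightarrow> 'a) \<Rightarrow> (nat \<Rightarrow> 'a set) \<Rightarrow> bool" where
  "closed_subspace_system scl V \<longleftrightarrow> (\<forall>k. closed (V k) \<and> module.subspace scl (V k))"

definition representing_system ::
  "('k::real_normed_field \<Rightarrow> 'a::real_normed_vector \<Rightarrow> 'a) \<Rightarrow> (nat \<Rightarrow> 'a set) \<Rightarrow> bool" where
  "representing_system scl V \<longleftrightarrow>
     closed_subspace_system scl V \<and> (\<forall>x. \<exists>u. (\<forall>k. u k \<in> V k) \<and> u sums x)"

definition permutational_representing_system ::
  "('k::real_normed_field \<Rightarrow> 'a::real_normed_vector \<Rightarrow> 'a) \<Rightarrow> (nat \<Rightarrow> 'a set) \<Rightarrow> bool" where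
  "permutational_representing_system scl V \<longleftrightarrow>
     (\<forall>\<sigma>::nat \<Rightarrow> nat. bij \<sigma> \<longrightarrow> representing_system scl (\<lambda>k. V (\<sigma> k)))"

definition Delta :: "(nat \<Rightarrow> 'a::real_normed_vector set) \<Rightarrow> 'a set" where
  "Delta V = {x. liminf (\<lambda>k. ereal (infdist x (V k))) = 0}"

end

theory Submission
  imports Defs
begin

text \<open>
  A point \<open>y\<close> of \<open>Delta V\<close> is approximated arbitrarily well by a single vector from \<open>V
  k\<close>, for infinitely many \<open>k\<close>; this condition does not depend on the order of the subspaces, so it
  suffices to expand a vector \<open>x\<close> along \<open>V\<close> itself. A linear combination of such points is
  approximated, beyond any given index, by a finite block of terms chosen from subspaces of increasing index, one term
  for each summand (\<open>bounded_blocks_span\<close>). The partial sums of such a block may be much larger than the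
  vector \<open>x\<close> that it approximates. The remedy is to write \<open>x\<close> as a sum of \<open>n\<close>
  copies of \<open>x / n\<close> and to concatenate blocks for these copies: the partial sums then stay near the
  segment from \<open>0\<close> to \<open>x\<close>, up to an error of order \<open>1 / n\<close>. The bound so
  obtained depends on \<open>x\<close> only through its norm and therefore passes to the closure of the span: every
  \<open>x\<close> has approximating blocks beyond any index whose partial sums have norm at most \<open>norm x +
  e\<close> (\<open>bounded_blocks_norm\<close>). Expanding \<open>x\<close>, then the remainder, then the remainder
  of the remainder, and so on, gives a series whose partial sums converge to \<open>x\<close>, because within each
  block they move by no more than about the norm of the current remainder (\<open>sums_of_bounded_blocks\<close>).
  Completeness is never needed, since the limit is known in advance.
\<close>

section \<open>Finite blocks with bounded partial sums\<close>

text \<open>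
  The vector \<open>x\<close> can be approximated, using only terms of index at least \<open>N\<close> for any
  prescribed \<open>N\<close>, by finite sums whose partial sums are bounded in norm by \<open>C\<close>, up to an
  arbitrarily small error. The sequence \<open>u\<close> is total; only its values on \<open>{N..<M}\<close> matter.
  Blocks are nonempty, so that infinitely many consecutive blocks exhaust all indices.
\<close>

definition bounded_blocks :: "(nat \<Rightarrow> 'a::real_normed_vector set) \<Rightarrow> real \<Rightarrow> 'a \<Rightarrow> bool" where
  "bounded_blocks V C x \<longleftrightarrow>
     (\<forall>e>0. \<forall>N. \<exists>M>N. \<exists>u. (\<forall>k. u k \<in> V k) \<and> norm (x - sum u {N..<M}) < e \<and>
        (\<forall>m\<in>{N..M}. norm (sum u {N..<m}) \<le> C + e))"

lemma bounded_blocksE: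
  assumes "bounded_blocks V C x" "e > 0"
  obtains M u where "M > N" "\<And>k. u k \<in> V k" "norm (x - sum u {N..<M}) < e"
    "\<And>m. N \<le> m \<Longrightarrow> m \<le> M \<Longrightarrow> norm (sum u {N..<m}) \<le> C + e"
  using assms unfolding bounded_blocks_def by (meson atLeastAtMost_iff)

lemma bounded_blocks_mono: "bounded_blocks V C x \<Longrightarrow> C \<le> D \<Longrightarrow> bounded_blocks V D x"
  unfolding bounded_blocks_def by (meson add_right_mono order_trans)

lemma bounded_blocks_single:
  assumes zero: "\<And>k. 0 \<in> V k"
    and freq: "\<And>e. e > 0 \<Longrightarrow> \<exists>\<^sub>\<infinity>k. infdist x (V k) < e"
  shows "bounded_blocks V (norm x) x"
  unfolding bounded_blocks_def
proof (intro allI impI)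
  fix e :: real and N :: nat
  assume e: "e > 0"
  obtain k where k: "k \<ge> N" "infdist x (V k) < e"
    using freq[OF e] by (auto simp: INFM_nat_le)
  then obtain v where v: "v \<in> V k" "dist x v < e"
    using zero[of k] by (auto simp: infdist_def cINF_less_iff split: if_splits)
  define u where "u = (\<lambda>i. if i = k then v else 0)"
  have sum_u: "sum u {N..<m} = (if k < m then v else 0)" for m
    using k by (simp add: u_def)
  have "norm v \<le> norm x + e"
    using v norm_triangle_sub[of v x] by (simp add: dist_norm norm_minus_commute)
  then have "\<forall>m\<in>{N..Suc k}. norm (sum u {N..<m}) \<le> norm x + e"
    using e by (simp add: sum_u)
  moreover have "norm (x - sum u {N..<Suc k}) < e"
    unfolding sum_u using v by (simp add: dist_norm)
  moreover have "\<forall>i. u i \<in> V i"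
    using zero v by (simp add: u_def)
  ultimately show "\<exists>M>N. \<exists>u. (\<forall>k. u k \<in> V k) \<and> norm (x - sum u {N..<M}) < e \<and>
        (\<forall>m\<in>{N..M}. norm (sum u {N..<m}) \<le> norm x + e)"
    using k by (intro exI[of _ "Suc k"] conjI exI[of _ u]) auto
qed

text \<open>Concatenating a block for \<open>x\<close> and a block for \<open>y\<close>.\<close>

lemma bounded_blocks_add:
  assumes x: "bounded_blocks V C x" and y: "bounded_blocks V D y"
  shows "bounded_blocks V (max C (norm x + D)) (x + y)"
  unfolding bounded_blocks_def
proof (intro allI impI)
  fix e :: real and N :: nat
  assume "e > 0"
  then have e: "e / 2 > 0"
    by simp
  obtain K u where u: "K > N" "\<And>k. u k \<in> V k" "norm (x - sum u {N..<K}) < e / 2"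
    "\<And>m. N \<le> m \<Longrightarrow> m \<le> K \<Longrightarrow> norm (sum u {N..<m}) \<le> C + e / 2"
    by (rule bounded_blocksE[OF x e, where N = N]) (rule that)
  obtain M v where v: "M > K" "\<And>k. v k \<in> V k" "norm (y - sum v {K..<M}) < e / 2"
    "\<And>m. K \<le> m \<Longrightarrow> m \<le> M \<Longrightarrow> norm (sum v {K..<m}) \<le> D + e / 2"
    by (rule bounded_blocksE[OF y e, where N = K]) (rule that)
  define w where "w = (\<lambda>i. if i < K then u i else v i)"
  have low: "sum w {N..<m} = sum u {N..<m}" if "m \<le> K" for m
    using that by (intro sum.cong) (auto simp: w_def)
  have high: "sum w {N..<m} = sum u {N..<K} + sum v {K..<m}" if "K \<le> m" for m
  proof -
    have "sum w {N..<m} = sum w {N..<K} + sum w {K..<m}"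
      using u(1) that by (simp add: sum.atLeastLessThan_concat)
    also have "sum w {K..<m} = sum v {K..<m}"
      by (intro sum.cong) (auto simp: w_def)
    finally show ?thesis
      by (simp add: low)
  qed
  have "norm (sum w {N..<m}) \<le> max C (norm x + D) + e" if m: "N \<le> m" "m \<le> M" for m
  proof (cases "m \<le> K")
    case True
    then show ?thesis
      using u(4)[of m] m e by (simp add: low)
  next
    case False
    have "norm (sum u {N..<K}) \<le> norm x + e / 2"
      using u(3) norm_triangle_sub[of "sum u {N..<K}" x] by (simp add: norm_minus_commute)
    moreover have "norm (sum v {K..<m}) \<le> D + e / 2"
      using False m by (intro v) auto
    ultimately show ?thesis
      using False norm_triangle_ineq[of "sum u {N..<K}" "sum v {K..<m}"] by (simp add: high)
  qed
  moreover have "norm (x + y - sum w {N..<M}) < e"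
    using norm_triangle_ineq[of "x - sum u {N..<K}" "y - sum v {K..<M}"] u(3) v(1,3)
    by (simp add: high algebra_simps)
  moreover have "w k \<in> V k" for k
    using u v by (simp add: w_def)
  ultimately show "\<exists>M>N. \<exists>u. (\<forall>k. u k \<in> V k) \<and> norm (x + y - sum u {N..<M}) < e \<and>
      (\<forall>m\<in>{N..M}. norm (sum u {N..<m}) \<le> max C (norm x + D) + e)"
    using u(1) v(1) by (intro exI[of _ M] conjI exI[of _ w]) auto
qed

lemma bounded_blocks_repeat:
  assumes x: "bounded_blocks V C x"
  shows "bounded_blocks V (real n * norm x + C) (real (Suc n) *\<^sub>R x)"
proof (induction n)
  case 0
  then show ?case
    using x by simp
next
  case (Suc n)
  have "bounded_blocks V (max (real n * norm x + C) (norm (real (Suc n) *\<^sub>R x) + C))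
      (real (Suc n) *\<^sub>R x + x)"
    by (rule bounded_blocks_add[OF Suc x])
  moreover have "real (Suc n) *\<^sub>R x + x = real (Suc (Suc n)) *\<^sub>R x"
    by (simp add: scaleR_left_distrib flip: scaleR_2)
  moreover have "max (real n * norm x + C) (norm (real (Suc n) *\<^sub>R x) + C) =
      real (Suc n) * norm x + C"
    by (simp add: mult_right_mono del: of_nat_Suc)
  ultimately show ?case
    by simp
qed

lemma bounded_blocks_closed_bound:
  assumes "\<And>d. d > 0 \<Longrightarrow> bounded_blocks V (C + d) x"
  shows "bounded_blocks V C x"
  unfolding bounded_blocks_def
proof (intro allI impI)
  fix e :: real and N :: nat
  assume "e > 0"
  then have e: "e / 2 > 0"
    by simp
  obtain M u where "M > N" "\<And>k. u k \<in> V k" "norm (x - sum u {N..<M}) < e / 2"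
    "\<And>m. N \<le> m \<Longrightarrow> m \<le> M \<Longrightarrow> norm (sum u {N..<m}) \<le> C + e / 2 + e / 2"
    by (rule bounded_blocksE[OF assms[OF e] e, where N = N]) (rule that)
  moreover from this have "norm (sum u {N..<m}) \<le> C + e" if "N \<le> m" "m \<le> M" for m
    using that by (fastforce simp: add.assoc)
  ultimately show "\<exists>M>N. \<exists>u. (\<forall>k. u k \<in> V k) \<and> norm (x - sum u {N..<M}) < e \<and>
      (\<forall>m\<in>{N..M}. norm (sum u {N..<m}) \<le> C + e)"
    using e by (intro exI[of _ M] conjI exI[of _ u]) auto
qed

lemma bounded_blocks_norm_closure:
  assumes x: "x \<in> closure S" and S: "\<And>y. y \<in> S \<Longrightarrow> bounded_blocks V (norm y) y"
  shows "bounded_blocks V (norm x) x"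
  unfolding bounded_blocks_def
proof (intro allI impI)
  fix e :: real and N :: nat
  assume "e > 0"
  then have e: "e / 2 > 0"
    by simp
  obtain y where y: "y \<in> S" "dist y x < e / 2"
    using x e unfolding closure_approachable by blast
  obtain M u where u: "M > N" "\<And>k. u k \<in> V k" "norm (y - sum u {N..<M}) < e / 2"
    "\<And>m. N \<le> m \<Longrightarrow> m \<le> M \<Longrightarrow> norm (sum u {N..<m}) \<le> norm y + e / 2"
    by (rule bounded_blocksE[OF S[OF y(1)] e, where N = N]) (rule that)
  have "norm y \<le> norm x + e / 2"
    using y norm_triangle_sub[of y x] by (simp add: dist_norm)
  then have "norm (sum u {N..<m}) \<le> norm x + e" if "N \<le> m" "m \<le> M" for m
    using u(4)[OF that] by simp
  moreover have "norm (x - sum u {N..<M}) < e"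
    using norm_triangle_ineq[of "x - y" "y - sum u {N..<M}"] u(3) y(2)
    by (simp add: dist_norm norm_minus_commute)
  ultimately show "\<exists>M>N. \<exists>u. (\<forall>k. u k \<in> V k) \<and> norm (x - sum u {N..<M}) < e \<and>
      (\<forall>m\<in>{N..M}. norm (sum u {N..<m}) \<le> norm x + e)"
    using u by (intro exI[of _ M] conjI exI[of _ u]) auto
qed

section \<open>Approximation of the closed span\<close>

context normed_space_over
begin

lemma bounded_blocks_scale:
  assumes V: "\<And>k. subspace (V k)" and x: "bounded_blocks V C x"
  shows "bounded_blocks V (norm c * C) (scl c x)"
  unfolding bounded_blocks_def
proof (intro allI impI)
  fix e :: real and N :: nat
  assume e: "e > 0"
  define d where "d = e / (norm c + 1)"
  have d: "d > 0"
    using e by (auto simp: d_def intro!: divide_pos_pos add_nonneg_pos)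
  have "(norm c + 1) * d = e"
    using norm_ge_zero[of c] by (simp add: d_def add_nonneg_eq_0_iff)
  then have cd: "norm c * d < e"
    using d by (simp add: algebra_simps)
  obtain M u where u: "M > N" "\<And>k. u k \<in> V k" "norm (x - sum u {N..<M}) < d"
    "\<And>m. N \<le> m \<Longrightarrow> m \<le> M \<Longrightarrow> norm (sum u {N..<m}) \<le> C + d"
    by (rule bounded_blocksE[OF x d, where N = N]) (rule that)
  define w where "w = (\<lambda>k. scl c (u k))"
  have sum: "sum w {N..<m} = scl c (sum u {N..<m})" for m
    by (simp add: w_def scale_sum_right)
  have "norm (sum w {N..<m}) \<le> norm c * C + e" if "N \<le> m" "m \<le> M" for m
    using mult_left_mono[OF u(4)[OF that] norm_ge_zero[of c]] cd
    by (simp add: sum norm_scale algebra_simps)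
  moreover have "norm (scl c x - sum w {N..<M}) < e"
    using mult_left_mono[OF less_imp_le[OF u(3)] norm_ge_zero[of c]] cd
    by (simp add: sum norm_scale flip: scale_right_diff_distrib)
  moreover have "w k \<in> V k" for k
    using u V by (simp add: w_def subspace_scale)
  ultimately show "\<exists>M>N. \<exists>u. (\<forall>k. u k \<in> V k) \<and> norm (scl c x - sum u {N..<M}) < e \<and>
      (\<forall>m\<in>{N..M}. norm (sum u {N..<m}) \<le> norm c * C + e)"
    using u(1) by (intro exI[of _ M] conjI exI[of _ w]) auto
qed

lemma bounded_blocks_span:
  assumes V: "\<And>k. subspace (V k)"
    and D: "\<And>y e. y \<in> D \<Longrightarrow> e > 0 \<Longrightarrow> \<exists>\<^sub>\<infinity>k. infdist y (V k) < e"
    and x: "x \<in> span D"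
  shows "\<exists>C. bounded_blocks V C x"
proof (rule span_induct_alt[OF x])
  have zero: "0 \<in> V k" for k
    using V by (simp add: subspace_0)
  have "infdist 0 (V k) = 0" for k
    using zero by simp
  then show "\<exists>C. bounded_blocks V C 0"
    using bounded_blocks_single[where V = V and x = 0, OF zero] by auto
  show "\<exists>C. bounded_blocks V C (scl c y + z)"
    if "y \<in> D" "\<exists>C. bounded_blocks V C z" for c y z
    using that bounded_blocks_add bounded_blocks_scale[OF V bounded_blocks_single[OF zero D]]
    by blast
qed

text \<open>Replacing a block for \<open>x\<close> by \<open>n + 1\<close> blocks for \<open>x / (n + 1)\<close> reduces the bound to
  \<open>norm x + C / (n + 1)\<close>, and \<open>n\<close> is arbitrary.\<close>

lemma bounded_blocks_average:
  assumes V: "\<And>k. subspace (V k)" and x: "bounded_blocks V C x"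
  shows "bounded_blocks V (norm x) x"
proof (rule bounded_blocks_closed_bound)
  fix d :: real
  assume d: "d > 0"
  obtain n where n: "C / d < real n"
    using reals_Archimedean2 by blast
  define t where "t = inverse (real (Suc n))"
  have t: "t > 0" "real (Suc n) * t = 1"
    by (simp_all add: t_def)
  have "C < real n * d"
    using n d by (simp add: field_simps)
  then have "C \<le> real (Suc n) * d"
    using d by (simp add: algebra_simps)
  then have "t * C \<le> t * (real (Suc n) * d)"
    using t by (intro mult_left_mono) auto
  also have "\<dots> = (real (Suc n) * t) * d"
    by (simp only: mult_ac)
  also have "\<dots> = d"
    by (simp only: t mult_1)
  finally have tC: "t * C \<le> d" .
  have "bounded_blocks V (t * C) (t *\<^sub>R x)"
    using bounded_blocks_scale[OF V x, of "of_real t"] t by (simp add: scale_of_real)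
  then have *: "bounded_blocks V (real n * norm (t *\<^sub>R x) + t * C) (real (Suc n) *\<^sub>R t *\<^sub>R x)"
    by (rule bounded_blocks_repeat)
  have "real n * t \<le> real (Suc n) * t"
    using t(1) by (intro mult_right_mono) auto
  then have "real n * t * norm x \<le> 1 * norm x"
    unfolding t by (rule mult_right_mono) simp
  then have "real n * norm (t *\<^sub>R x) + t * C \<le> norm x + d"
    using tC t(1) by simp
  with * have "bounded_blocks V (norm x + d) (real (Suc n) *\<^sub>R t *\<^sub>R x)"
    by (rule bounded_blocks_mono)
  then show "bounded_blocks V (norm x + d) x"
    unfolding scaleR_scaleR t by simp
qed

lemma bounded_blocks_norm:
  assumes V: "\<And>k. subspace (V k)"
    and D: "\<And>y e. y \<in> D \<Longrightarrow> e > 0 \<Longrightarrow> \<exists>\<^sub>\<infinity>k. infdist y (V k) < e"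
    and x: "x \<in> closure (span D)"
  shows "bounded_blocks V (norm x) x"
  using x
proof (rule bounded_blocks_norm_closure)
  show "bounded_blocks V (norm y) y" if y: "y \<in> span D" for y
  proof -
    obtain C where "bounded_blocks V C y"
      using bounded_blocks_span[OF V D y] by auto
    then show ?thesis
      by (rule bounded_blocks_average[OF V])
  qed
qed

end

section \<open>Series from successive blocks\<close>

lemma sums_of_bounded_blocks:
  assumes B: "\<And>x. bounded_blocks V (norm x) x"
  shows "\<exists>u. (\<forall>k. u k \<in> V k) \<and> u sums x"
proof -
  \<comment> \<open>The summand \<open>1\<close> keeps the scale of the errors positive when \<open>x = 0\<close>.\<close>
  define c where "c = norm x + 1"
  have c: "c > 0"
    using norm_ge_zero[of x] unfolding c_def by linarith
  \<comment> \<open>A pair \<open>(N, u)\<close> records that the terms \<open>u k\<close> with \<open>k < N\<close> are final. Stage \<open>j\<close> leaves a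
    remainder \<open>r\<close> of norm at most \<open>c / 2 ^ j\<close>; the constant \<open>3\<close> in \<open>ext\<close> bounds the sum of
    \<open>norm r\<close> and the norm \<open>norm r + e\<close> of a partial sum of the next block.\<close>
  define good where "good j p \<longleftrightarrow>
      (\<forall>k. snd p k \<in> V k) \<and> norm (x - sum (snd p) {..<fst p}) \<le> c / 2 ^ j"
    for j :: nat and p :: "nat \<times> (nat \<Rightarrow> 'a)"
  define ext where "ext j p q \<longleftrightarrow> fst p < fst q \<and> (\<forall>k<fst p. snd q k = snd p k) \<and>
      (\<forall>m\<in>{fst p..fst q}. norm (x - sum (snd q) {..<m}) \<le> 3 * c / 2 ^ j)"
    for j :: nat and p q :: "nat \<times> (nat \<Rightarrow> 'a)"
  have "\<exists>f. \<forall>j. good j (f j) \<and> ext j (f j) (f (Suc j))"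
  proof (rule dependent_nat_choice)
    obtain u where "\<And>k. u k \<in> V k"
      by (rule bounded_blocksE[OF B zero_less_one, where N = 0]) (rule that)
    then have "good 0 (0, u)"
      by (simp add: good_def c_def)
    then show "\<exists>p. good 0 p" ..
  next
    fix p j
    assume p: "good j p"
    define N where "N = fst p"
    define u where "u = snd p"
    define r where "r = x - sum u {..<N}"
    have u: "\<And>k. u k \<in> V k" and r: "norm r \<le> c / 2 ^ j"
      using p by (simp_all add: good_def N_def u_def r_def)
    have e: "c / 2 ^ Suc j > 0"
      using c by simp
    obtain M v where v: "M > N" "\<And>k. v k \<in> V k" "norm (r - sum v {N..<M}) < c / 2 ^ Suc j"
      "\<And>m. N \<le> m \<Longrightarrow> m \<le> M \<Longrightarrow> norm (sum v {N..<m}) \<le> norm r + c / 2 ^ Suc j"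
      by (rule bounded_blocksE[OF B e, where N = N]) (rule that)
    define w where "w = (\<lambda>i. if i < N then u i else v i)"
    have w: "x - sum w {..<m} = r - sum v {N..<m}" if "N \<le> m" for m
    proof -
      have "sum w {..<m} = sum w {..<N} + sum w {N..<m}"
        using that by (simp add: lessThan_atLeast0 sum.atLeastLessThan_concat)
      also have "sum w {..<N} = sum u {..<N}"
        by (intro sum.cong) (auto simp: w_def)
      also have "sum w {N..<m} = sum v {N..<m}"
        by (intro sum.cong) (auto simp: w_def)
      finally show ?thesis
        by (simp add: r_def)
    qed
    have "norm (x - sum w {..<m}) \<le> 3 * c / 2 ^ j" if m: "N \<le> m" "m \<le> M" for m
    proof -
      have "norm (x - sum w {..<m}) \<le> norm r + norm (sum v {N..<m})"
        unfolding w[OF m(1)] by (rule norm_triangle_ineq4)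
      also have "\<dots> \<le> norm r + (norm r + c / 2 ^ Suc j)"
        using v(4)[OF m] by simp
      also have "\<dots> \<le> c / 2 ^ j + (c / 2 ^ j + c / 2 ^ j)"
        using r c by (intro add_mono) (auto simp: field_simps)
      finally show ?thesis
        by simp
    qed
    moreover have "norm (x - sum w {..<M}) \<le> c / 2 ^ Suc j"
      using v(1,3) by (simp add: w)
    moreover have "w k \<in> V k" for k
      using u v by (simp add: w_def)
    ultimately have "good (Suc j) (M, w) \<and> ext j p (M, w)"
      using v(1) by (simp add: good_def ext_def w_def flip: N_def u_def)
    then show "\<exists>q. good (Suc j) q \<and> ext j p q" ..
  qed
  then obtain f where f: "\<And>j. good j (f j)" "\<And>j. ext j (f j) (f (Suc j))"
    by blast
  define N where "N = (\<lambda>j. fst (f j))"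
  define u where "u = (\<lambda>j. snd (f j))"
  have N: "N j < N (Suc j)" for j
    using f(2)[of j] by (simp add: ext_def N_def)
  have uV: "u j k \<in> V k" for j k
    using f(1)[of j] by (simp add: good_def u_def)
  have u_Suc: "u (Suc j) k = u j k" if "k < N j" for j k
    using f(2)[of j] that by (simp add: ext_def N_def u_def)
  have u_bound: "norm (x - sum (u (Suc j)) {..<m}) \<le> 3 * c / 2 ^ j"
    if "N j \<le> m" "m \<le> N (Suc j)" for j m
    using f(2)[of j] that by (simp add: ext_def N_def u_def)
  have mono: "strict_mono N"
    using N by (simp add: strict_mono_Suc_iff)
  then have le_N: "j \<le> N j" for j
    by (rule seq_suble)
  have u_eq: "u i k = u j k" if "j \<le> i" "k < N j" for i j k
    using that(1)
  proof (induction i rule: dec_induct)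
    case (step i)
    have "N j \<le> N i"
      using step(1) mono by (simp add: strict_mono_less_eq)
    then show ?case
      using step that(2) by (simp add: u_Suc)
  qed simp
  \<comment> \<open>The term of index \<open>k\<close> is final in \<open>f (Suc k)\<close>, since \<open>k < N (Suc k)\<close>.\<close>
  define s where "s = (\<lambda>k. u (Suc k) k)"
  have s: "s k = u j k" if "k < N j" for j k
    using u_eq[of j "Suc k" k] u_eq[of "Suc k" j k] le_N[of "Suc k"] that
    by (cases "j \<le> Suc k") (simp_all add: s_def)
  have bound: "\<forall>m. N j \<le> m \<longrightarrow> m \<le> N (j + i) \<longrightarrow> norm (x - sum s {..<m}) \<le> 3 * c / 2 ^ j" for i j
  proof (induction i)
    case 0
    show ?case
    proof (intro allI impI)
      fix m assume m: "N j \<le> m" "m \<le> N (j + 0)"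
      then have "sum s {..<m} = sum (u (Suc j)) {..<m}"
        using N[of j] by (intro sum.cong) (auto intro!: s)
      then show "norm (x - sum s {..<m}) \<le> 3 * c / 2 ^ j"
        using u_bound[of j m] m N[of j] by simp
    qed
  next
    case (Suc i)
    show ?case
    proof (intro allI impI)
      fix m assume m: "N j \<le> m" "m \<le> N (j + Suc i)"
      show "norm (x - sum s {..<m}) \<le> 3 * c / 2 ^ j"
      proof (cases "m \<le> N (j + i)")
        case True
        then show ?thesis
          using Suc m by simp
      next
        case False
        have "sum s {..<m} = sum (u (Suc (j + i))) {..<m}"
          using m by (intro sum.cong) (auto intro!: s)
        then have "norm (x - sum s {..<m}) \<le> 3 * c / 2 ^ (j + i)"
          using u_bound[of "j + i" m] m False by simp
        also have "\<dots> \<le> 3 * c / 2 ^ j"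
          using c by (intro divide_left_mono power_increasing) auto
        finally show ?thesis .
      qed
    qed
  qed
  have "s sums x"
    unfolding sums_def
  proof (rule LIMSEQ_I)
    fix e :: real
    assume e: "e > 0"
    obtain j where "3 * c / e < 2 ^ j"
      using real_arch_pow[of 2 "3 * c / e"] by auto
    then have j: "3 * c / 2 ^ j < e"
      using e by (simp add: field_simps)
    have "norm (sum s {..<m} - x) < e" if "N j \<le> m" for m
    proof -
      have "m \<le> N (j + m)"
        using le_N[of "j + m"] by simp
      then have "norm (x - sum s {..<m}) \<le> 3 * c / 2 ^ j"
        using bound that by blast
      then show ?thesis
        using j by (simp add: norm_minus_commute)
    qed
    then show "\<exists>n0. \<forall>m\<ge>n0. norm (sum s {..<m} - x) < e"
      by blast
  qed
  moreover have "s k \<in> V k" for k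
    by (simp add: s_def uV)
  ultimately show ?thesis
    by blast
qed

section \<open>Permutations of the system\<close>

lemma Delta_frequently_close:
  assumes "x \<in> Delta V" "e > 0"
  shows "\<exists>\<^sub>\<infinity>k. infdist x (V k) < e"
proof (rule ccontr)
  assume "\<not> ?thesis"
  then have "eventually (\<lambda>k. ereal e \<le> ereal (infdist x (V k))) sequentially"
    by (simp add: frequently_def cofinite_eq_sequentially not_less)
  then have "ereal e \<le> liminf (\<lambda>k. ereal (infdist x (V k)))"
    by (rule Liminf_bounded)
  then show False
    using assms by (simp add: Delta_def)
qed

theorem mainTheorem4:
  fixes scl :: "'k::real_normed_field \<Rightarrow> 'a::real_normed_vector \<Rightarrow> 'a"
    and V :: "nat \<Rightarrow> 'a set"
  assumes "normed_space_over scl"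
    and "closed_subspace_system scl V"
    and "closure (module.span scl (Delta V)) = UNIV"
  shows "permutational_representing_system scl V"
  unfolding permutational_representing_system_def representing_system_def
proof (intro allI impI conjI)
  interpret normed_space_over scl
    by fact
  fix \<sigma> :: "nat \<Rightarrow> nat"
  assume \<sigma>: "bij \<sigma>"
  show "closed_subspace_system scl (\<lambda>k. V (\<sigma> k))"
    using assms(2) by (simp add: closed_subspace_system_def)
  have "subspace (V (\<sigma> k))" for k
    using assms(2) by (simp add: closed_subspace_system_def)
  moreover have "\<exists>\<^sub>\<infinity>k. infdist y (V (\<sigma> k)) < e" if "y \<in> Delta V" "e > 0" for y e
  proof -
    have "infinite {k. infdist y (V k) < e}"
      using Delta_frequently_close[OF that] by (simp add: INFM_iff_infinite)
    then have "infinite (\<sigma> -` {k. infdist y (V k) < e})"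
      using \<sigma> by (metis bij_is_surj finite_imageI surj_image_vimage_eq)
    then show ?thesis
      by (simp add: INFM_iff_infinite vimage_def)
  qed
  ultimately have "bounded_blocks (\<lambda>k. V (\<sigma> k)) (norm x) x" for x
    using assms(3) by (intro bounded_blocks_norm[where D = "Delta V"]) auto
  then show "\<exists>u. (\<forall>k. u k \<in> V (\<sigma> k)) \<and> u sums x" for x
    by (rule sums_of_bounded_blocks)
qed

end
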